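(* Let $(R,\|\cdot\|)$ be a unitary commutative normed $\mathbb{R}$-algebra with $\mathcal{X}_R=\mathrm{Hom}(R,\mathbb{R})$ nonempty, and let $d\ge 1$ be an integer. Then $\mathcal{K}_{\|\cdot\|}$ is compact and $$\overline{\sum R^{2d}}^{\,\|\cdot\|}=\mathrm{Psd}(\mathcal{K}_{\|\cdot\|}).$$
   Context: A normed $\mathbb{R}$-algebra is an $\mathbb{R}$-algebra with a norm satisfying $\|xy\|\le\|x\|\,\|y\|$ for all $x,y$ (completeness is not assumed). $\mathcal{X}_R=\mathrm{Hom}(R,\mathbb{R})$ is the set of unitary homomorphisms $\alpha:R\to\mathbb{R}$, with the subspace topology inherited from the product topology on $\mathbb{R}^R$. $\mathcal{K}_{\|\cdot\|}$ (the global, or Gelfand, spectrum) is the set of all $\|\cdot\|$-continuous $\alpha\in\mathcal{X}_R$, with the subspace topology. $\sum R^{2d}$ is the set of finite sums of $2d$-th powers of elements of $R$. For $K\subseteq\mathcal{X}_R$, $\mathrm{Psd}(K):=\{a\in R:\alpha(a)\ge0\text{ for all }\alpha\in K\}$ (so $\mathrm{Psd}(\emptyset)=R$). The overline denotes closure in the norm topology. *)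

theory Defs
  imports "HOL-Analysis.Analysis"
begin

text \<open>
  A unitary commutative normed algebra over the reals is a type of sort
  \<open>{real_normed_algebra, comm_ring_1}\<close>: the norm is submultiplicative, completeness is not
  assumed, and neither is \<open>norm 1 = 1\<close> (which \<open>real_normed_algebra_1\<close> would impose).
  The class axiom \<open>0 \<noteq> 1\<close> is no restriction in the presence of a unitary homomorphism to
  the reals.
\<close>

definition real_characters :: "('a::{real_algebra, comm_ring_1} \<Rightarrow> real) set" where
  "real_characters =
     {\<alpha>. linear \<alpha> \<and> (\<forall>x y. \<alpha> (x * y) = \<alpha> x * \<alpha> y) \<and> \<alpha> 1 = 1}"

text \<open>
  The function type \<open>'a \<Rightarrow> real\<close> carries the product topology, so topological notions such as
  \<open>compact\<close>, applied to sets of characters, refer to the topology of pointwise convergence.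
\<close>

definition gelfand_spectrum :: "('a::{real_normed_algebra, comm_ring_1} \<Rightarrow> real) set" where
  "gelfand_spectrum = {\<alpha> \<in> real_characters. continuous_on UNIV \<alpha>}"

definition sums_of_powers :: "nat \<Rightarrow> 'a::comm_ring_1 set" where
  "sums_of_powers m = {\<Sum>x\<leftarrow>xs. x ^ m | xs. True}"

definition Psd :: "('a::{real_algebra, comm_ring_1} \<Rightarrow> real) set \<Rightarrow> 'a set" where
  "Psd K = {a. \<forall>\<alpha>\<in>K. \<alpha> a \<ge> 0}"

end

theory Submission
  imports Defs
begin

text \<open>
  Let \<open>M\<close> be the closure of the sums of \<open>2d\<close>-th powers. If \<open>a\<close> is small, \<open>1 + a\<close> is a limit of
  \<open>2d\<close>-th powers, so \<open>C \<parallel>a\<parallel> + a \<in> M\<close> for all \<open>a\<close> and a fixed \<open>C\<close>: \<open>M\<close> is an archimedean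
  preprime, and the characters nonnegative on \<open>M\<close> are bounded by \<open>C \<parallel>\<cdot>\<parallel>\<close>, hence are exactly the
  continuous ones. This gives compactness by Tychonoff. By the Kadison--Dubois theorem any
  \<open>b \<notin> M\<close> satisfies \<open>\<alpha> b \<le> 0\<close> for some such character; applied to \<open>b = a + \<epsilon>\<close> it shows that
  \<open>a + \<epsilon> \<in> M\<close> for all \<open>a\<close> nonnegative on the spectrum and all \<open>\<epsilon> > 0\<close>, and \<open>M\<close> is closed.
\<close>

section \<open>Archimedean preprimes\<close>

text \<open>
  Real scalars are written \<open>r *\<^sub>R 1\<close>, since the sort at hand does not provide \<open>of_real\<close>.
\<close>

locale archimedean_preprime =
  fixes M :: "'a::{real_algebra, comm_ring_1} set"
  assumes add: "a \<in> M \<Longrightarrow> b \<in> M \<Longrightarrow> a + b \<in> M"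
    and mult: "a \<in> M \<Longrightarrow> b \<in> M \<Longrightarrow> a * b \<in> M"
    and scalar: "0 \<le> r \<Longrightarrow> r *\<^sub>R 1 \<in> M"
    and archimedean: "\<exists>k. k *\<^sub>R 1 + a \<in> M"
begin

section \<open>Modules over the preprime and their maximal elements\<close>

text \<open>Closure is under products with \<open>M\<close> only, not within \<open>Q\<close>;
  multiplicativity of the resulting character is recovered later from the kernel of the cut.\<close>

definition proper_module :: "'a set \<Rightarrow> bool" where
  "proper_module Q \<longleftrightarrow> M \<subseteq> Q \<and> (\<forall>a\<in>Q. \<forall>b\<in>Q. a + b \<in> Q) \<and>
     (\<forall>t\<in>M. \<forall>a\<in>Q. t * a \<in> Q) \<and> - 1 \<notin> Q"

lemma proper_moduleD:
  assumes "proper_module Q"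
  shows "M \<subseteq> Q" "\<And>a b. a \<in> Q \<Longrightarrow> b \<in> Q \<Longrightarrow> a + b \<in> Q"
    "\<And>t a. t \<in> M \<Longrightarrow> a \<in> Q \<Longrightarrow> t * a \<in> Q" "- 1 \<notin> Q"
  using assms unfolding proper_module_def by auto

lemma zero_mem: "0 \<in> M" and one_mem: "1 \<in> M"
  using scalar[of 0] scalar[of 1] by auto

lemma scaleR_mem: "0 \<le> r \<Longrightarrow> a \<in> M \<Longrightarrow> r *\<^sub>R a \<in> M"
  using mult[OF scalar] by simp

lemma proper_module_scaleR:
  assumes "proper_module Q" "0 \<le> r" "a \<in> Q"
  shows "r *\<^sub>R a \<in> Q"
  using proper_moduleD(3)[OF assms(1) scalar[OF assms(2)] assms(3)] by simp

lemma archimedean_nonneg: obtains k where "0 < k" "k *\<^sub>R 1 + a \<in> M"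
proof -
  obtain k where k: "k *\<^sub>R 1 + a \<in> M" using archimedean by blast
  have "(\<bar>k\<bar> + 1 - k) *\<^sub>R 1 + (k *\<^sub>R 1 + a) \<in> M"
    by (rule add[OF scalar k]) simp
  then have "(\<bar>k\<bar> + 1) *\<^sub>R 1 + a \<in> M" by (simp add: algebra_simps)
  then show thesis by (intro that[of "\<bar>k\<bar> + 1"]) auto
qed

text \<open>Zorn's lemma: the union of a nonempty chain of proper modules is again one, because any
  two elements share a member of the chain and \<open>- 1\<close> lies in no member.\<close>

lemma ex_maximal_proper_module:
  assumes "proper_module Q0"
  obtains Q where "proper_module Q" "Q0 \<subseteq> Q"
    "\<forall>Q'. proper_module Q' \<longrightarrow> Q \<subseteq> Q' \<longrightarrow> Q' = Q"
proof -
  let ?A = "{Q. proper_module Q \<and> Q0 \<subseteq> Q}"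
  have "\<exists>Q\<in>?A. \<forall>X\<in>?A. Q \<subseteq> X \<longrightarrow> X = Q"
  proof (rule subset_Zorn_nonempty)
    show "?A \<noteq> {}" using assms by auto
    fix C assume C: "C \<noteq> {}" "subset.chain ?A C"
    have CA: "\<And>Q. Q \<in> C \<Longrightarrow> proper_module Q \<and> Q0 \<subseteq> Q"
      using C(2) by (auto simp: subset.chain_def)
    have lin: "\<And>Q Q'. Q \<in> C \<Longrightarrow> Q' \<in> C \<Longrightarrow> Q \<subseteq> Q' \<or> Q' \<subseteq> Q"
      using C(2) by (auto simp: subset_chain_def)
    have "a + b \<in> \<Union>C" if ab: "a \<in> \<Union>C" "b \<in> \<Union>C" for a b
    proof -
      from ab obtain Q Q' where Q: "a \<in> Q" "Q \<in> C" "b \<in> Q'" "Q' \<in> C" by blast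
      then obtain P where "P \<in> C" "a \<in> P" "b \<in> P" using lin by blast
      then show ?thesis using CA proper_moduleD(2) by blast
    qed
    moreover have "t * a \<in> \<Union>C" if "t \<in> M" "a \<in> \<Union>C" for t a
      using that CA proper_moduleD(3) by blast
    moreover have "M \<subseteq> \<Union>C" "Q0 \<subseteq> \<Union>C" "- 1 \<notin> \<Union>C"
      using C(1) CA proper_moduleD(1,4) by blast+
    ultimately show "\<Union>C \<in> ?A" by (auto simp: proper_module_def)
  qed
  then obtain Q where Q: "proper_module Q" "Q0 \<subseteq> Q"
    and "\<forall>X\<in>?A. Q \<subseteq> X \<longrightarrow> X = Q" by blast
  then show thesis by (intro that[of Q]) auto
qed

definition adjoin :: "'a set \<Rightarrow> 'a \<Rightarrow> 'a set" where
  "adjoin Q a = {q + t * a | q t. q \<in> Q \<and> t \<in> M}"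

lemma adjoinI: "q \<in> Q \<Longrightarrow> t \<in> M \<Longrightarrow> x = q + t * a \<Longrightarrow> x \<in> adjoin Q a"
  unfolding adjoin_def by blast

lemma subset_adjoin: "Q \<subseteq> adjoin Q a"
proof
  fix q assume "q \<in> Q"
  then show "q \<in> adjoin Q a" by (rule adjoinI[OF _ zero_mem]) simp
qed

lemma mem_adjoin:
  assumes "M \<subseteq> Q"
  shows "a \<in> adjoin Q a"
  using assms zero_mem one_mem by (intro adjoinI[of 0 _ 1]) auto

text \<open>The module laws are separate hypotheses so that \<open>Q\<close> may be \<open>M\<close>
  itself as well as a maximal module.\<close>

lemma proper_module_adjoin:
  assumes sub: "M \<subseteq> Q" and Qadd: "\<And>a b. a \<in> Q \<Longrightarrow> b \<in> Q \<Longrightarrow> a + b \<in> Q"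
    and Qmult: "\<And>t a. t \<in> M \<Longrightarrow> a \<in> Q \<Longrightarrow> t * a \<in> Q" and "- 1 \<notin> adjoin Q a"
  shows "proper_module (adjoin Q a)"
  unfolding proper_module_def
proof (intro conjI ballI)
  show "M \<subseteq> adjoin Q a" using sub subset_adjoin by blast
  show "- 1 \<notin> adjoin Q a" by fact
next
  fix x y assume "x \<in> adjoin Q a" "y \<in> adjoin Q a"
  then obtain p s q t where "x = p + s * a" "y = q + t * a" "p \<in> Q" "q \<in> Q" "s \<in> M" "t \<in> M"
    unfolding adjoin_def by blast
  then show "x + y \<in> adjoin Q a"
    by (intro adjoinI[of "p + q" _ "s + t"] add Qadd) (auto simp: algebra_simps)
next
  fix s x assume "s \<in> M" "x \<in> adjoin Q a"
  then obtain q t where "x = q + t * a" "q \<in> Q" "t \<in> M" "s \<in> M" unfolding adjoin_def by blast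
  then show "s * x \<in> adjoin Q a"
    by (intro adjoinI[of "s * q" _ "s * t"] mult Qmult) (auto simp: algebra_simps)
qed

text \<open>If both fail, maximality writes \<open>- 1\<close> as \<open>q1 + t1 * a\<close> and as
  \<open>q2 - t2 * a\<close>. Eliminating \<open>a\<close> puts \<open>- t1\<close> in
  \<open>Q\<close>, and the archimedean axiom then puts \<open>- 1\<close> there.\<close>

lemma maximal_proper_module_total:
  assumes Q: "proper_module Q"
    and max: "\<forall>Q'. proper_module Q' \<longrightarrow> Q \<subseteq> Q' \<longrightarrow> Q' = Q"
  shows "a \<in> Q \<or> - a \<in> Q"
proof (rule ccontr)
  note D = proper_moduleD[OF Q]
  assume neg: "\<not> (a \<in> Q \<or> - a \<in> Q)"
  have *: "- 1 \<in> adjoin Q x" if "x \<notin> Q" for x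
  proof (rule ccontr)
    assume "- 1 \<notin> adjoin Q x"
    then have "proper_module (adjoin Q x)" by (intro proper_module_adjoin D)
    then have "adjoin Q x = Q" using max subset_adjoin by blast
    then show False using that mem_adjoin[OF D(1)] by blast
  qed
  obtain q1 t1 where 1: "- 1 = q1 + t1 * a" "q1 \<in> Q" "t1 \<in> M"
    using *[of a] neg unfolding adjoin_def by blast
  obtain q2 t2 where 2: "- 1 = q2 + t2 * - a" "q2 \<in> Q" "t2 \<in> M"
    using *[of "- a"] neg unfolding adjoin_def by blast
  have "t2 * q1 + t1 * q2 + t2 = - t1"
  proof -
    have "t2 * q1 + t1 * q2 = t2 * (- 1 - t1 * a) + t1 * (- 1 + t2 * a)"
      using 1(1) 2(1) by (simp add: algebra_simps)
    then show ?thesis by (simp add: algebra_simps)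
  qed
  then have t1: "- t1 \<in> Q"
    using D(2)[OF D(2)[OF D(3)[OF 2(3) 1(2)] D(3)[OF 1(3) 2(2)]], of t2] D(1) 2(3) by auto
  obtain k where k: "0 < k" "k *\<^sub>R 1 + a \<in> M" by (rule archimedean_nonneg)
  \<comment> \<open>\<open>a\<close> is outside \<open>M\<close>, but
    \<open>k *\<^sub>R 1 + a\<close> is inside; the excess \<open>k *\<^sub>R t1\<close> is
    cancelled by means of \<open>- t1\<close>.\<close>
  have "q1 + t1 * (k *\<^sub>R 1 + a) + k *\<^sub>R (- t1) \<in> Q"
    using D(1) mult[OF 1(3) k(2)] k(1)
    by (intro D(2) 1(2) proper_module_scaleR[OF Q] t1) auto
  also have "q1 + t1 * (k *\<^sub>R 1 + a) + k *\<^sub>R (- t1) = - 1"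
    using 1(1) by (simp add: algebra_simps)
  finally show False using D(4) by blast
qed

lemma proper_module_scalar_iff:
  assumes Q: "proper_module Q"
  shows "r *\<^sub>R 1 \<in> Q \<longleftrightarrow> 0 \<le> r"
proof
  assume r: "r *\<^sub>R 1 \<in> Q"
  show "0 \<le> r"
  proof (rule ccontr)
    assume "\<not> 0 \<le> r"
    then show False
      using proper_module_scaleR[OF Q _ r, of "- inverse r"] proper_moduleD(4)[OF Q] by auto
  qed
qed (use scalar proper_moduleD(1)[OF Q] in blast)

section \<open>Characters from Dedekind cuts\<close>

text \<open>For a proper module the archimedean axiom makes this set of lower scalars nonempty and
  bounded above, so that \<open>Sup\<close> is meaningful.\<close>

definition cut :: "'a set \<Rightarrow> 'a \<Rightarrow> real" where
  "cut Q a = Sup {r. a - r *\<^sub>R 1 \<in> Q}"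

text \<open>Totality turns the failure of a lower bound into an upper bound. Membership at
  \<open>r = cut Q a\<close> itself stays open, hence the strict inequalities.\<close>

lemma cut_bounds:
  assumes Q: "proper_module Q" and total: "\<And>a. a \<in> Q \<or> - a \<in> Q"
  shows "r < cut Q a \<Longrightarrow> a - r *\<^sub>R 1 \<in> Q" and "cut Q a < r \<Longrightarrow> r *\<^sub>R 1 - a \<in> Q"
    and "a - r *\<^sub>R 1 \<in> Q \<Longrightarrow> r \<le> cut Q a" and "r *\<^sub>R 1 - a \<in> Q \<Longrightarrow> cut Q a \<le> r"
proof -
  note D = proper_moduleD[OF Q]
  let ?S = "{r. a - r *\<^sub>R 1 \<in> Q}"
  obtain k where "k *\<^sub>R 1 + a \<in> M" using archimedean by blast
  then have "- k \<in> ?S" using D(1) by (auto simp: algebra_simps)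
  then have ne: "?S \<noteq> {}" by blast
  have le: "s \<le> r" if "s \<in> ?S" "r *\<^sub>R 1 - a \<in> Q" for s r
  proof -
    have "(a - s *\<^sub>R 1) + (r *\<^sub>R 1 - a) \<in> Q" using that by (intro D(2)) auto
    then have "(r - s) *\<^sub>R 1 \<in> Q" by (simp add: algebra_simps)
    then show ?thesis using proper_module_scalar_iff[OF Q] by auto
  qed
  obtain l where "l *\<^sub>R 1 + - a \<in> M" using archimedean by blast
  then have "l *\<^sub>R 1 - a \<in> Q" using D(1) by auto
  then have bdd: "bdd_above ?S" using le by (intro bdd_aboveI[of _ l]) auto
  show "a - r *\<^sub>R 1 \<in> Q" if r: "r < cut Q a" for r
  proof -
    obtain s where s: "s \<in> ?S" "r < s" using r less_cSup_iff[OF ne bdd] unfolding cut_def by blast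
    have "(a - s *\<^sub>R 1) + (s - r) *\<^sub>R 1 \<in> Q"
      using s proper_module_scalar_iff[OF Q] by (intro D(2)) auto
    then show ?thesis by (simp add: algebra_simps)
  qed
  show upper: "r \<le> cut Q a" if "a - r *\<^sub>R 1 \<in> Q" for r
    unfolding cut_def using that bdd by (intro cSup_upper) auto
  show "r *\<^sub>R 1 - a \<in> Q" if "cut Q a < r" for r
    using total[of "a - r *\<^sub>R 1"] upper[of r] that by auto
  show "cut Q a \<le> r" if "r *\<^sub>R 1 - a \<in> Q" for r
    unfolding cut_def using le that ne by (intro cSup_least) auto
qed

text \<open>Two-sided approximations up to every \<open>e\<close> determine a cut, which gives
  additivity. Multiplicativity follows once the kernel is an ideal, since
  \<open>b - cut Q b *\<^sub>R 1\<close> lies in it.\<close>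

lemma cut_character:
  assumes Q: "proper_module Q" and total: "\<And>a. a \<in> Q \<or> - a \<in> Q"
  shows "cut Q \<in> real_characters" and "a \<in> Q \<Longrightarrow> 0 \<le> cut Q a"
proof -
  note D = proper_moduleD[OF Q]
  note B = cut_bounds[OF Q total]
  have eqI: "cut Q a = c"
    if "\<And>e. 0 < e \<Longrightarrow> a - (c - e) *\<^sub>R 1 \<in> Q" "\<And>e. 0 < e \<Longrightarrow> (c + e) *\<^sub>R 1 - a \<in> Q" for a c
  proof (rule antisym)
    show "cut Q a \<le> c" using B(4)[OF that(2)] by (rule field_le_epsilon)
    have "c \<le> cut Q a + e" if "0 < e" for e
      using B(3)[OF \<open>\<And>e. 0 < e \<Longrightarrow> a - (c - e) *\<^sub>R 1 \<in> Q\<close>[OF that]] by simp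
    then show "c \<le> cut Q a" by (rule field_le_epsilon)
  qed
  have lo: "a - (cut Q a - e) *\<^sub>R 1 \<in> Q" and hi: "(cut Q a + e) *\<^sub>R 1 - a \<in> Q" if "0 < e" for a e
    using that by (auto intro: B(1,2))
  have add: "cut Q (a + b) = cut Q a + cut Q b" for a b
  proof (rule eqI)
    fix e :: real assume e: "0 < e"
    show "a + b - (cut Q a + cut Q b - e) *\<^sub>R 1 \<in> Q"
      using D(2)[OF lo[of "e/2" a] lo[of "e/2" b]] e
      by (simp add: algebra_simps flip: scaleR_add_left)
    show "(cut Q a + cut Q b + e) *\<^sub>R 1 - (a + b) \<in> Q"
      using D(2)[OF hi[of "e/2" a] hi[of "e/2" b]] e
      by (simp add: algebra_simps flip: scaleR_add_left)
  qed
  have scalar_cut: "cut Q (r *\<^sub>R 1) = r" for r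
    using proper_module_scalar_iff[OF Q]
    by (intro eqI) (auto simp flip: scaleR_diff_left)
  have pos: "0 \<le> cut Q a" if "a \<in> Q" for a using B(3)[of a 0] that by simp
  then show "a \<in> Q \<Longrightarrow> 0 \<le> cut Q a" .
  have zero: "cut Q 0 = 0" using scalar_cut[of 0] by simp
  have minus: "cut Q (- a) = - cut Q a" for a using add[of a "- a"] zero by simp
  have diff: "cut Q (a - b) = cut Q a - cut Q b" for a b using add[of a "- b"] minus by simp
  \<comment> \<open>\<open>M\<close> generates the ring additively, so the kernel of the cut is an ideal once \<open>M\<close> preserves it.\<close>
  have kerM: "cut Q (t * a) = 0" if t: "t \<in> M" and a: "cut Q a = 0" for t a
  proof -
    obtain k where k: "0 < k" "k *\<^sub>R 1 + - t \<in> M" by (rule archimedean_nonneg)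
    \<comment> \<open>Multiplying \<open>(e / k) *\<^sub>R 1 + b\<close> by \<open>t\<close> leaves
      the non-scalar error \<open>(e / k) *\<^sub>R t\<close>; adding \<open>e / k\<close> times
      \<open>k *\<^sub>R 1 - t\<close>, an element of \<open>M\<close>, turns it into the scalar
      \<open>e\<close>.\<close>
    have *: "e *\<^sub>R 1 + t * b \<in> Q" if b: "cut Q b = 0" and e: "0 < e" for b e
    proof -
      have "(e / k) *\<^sub>R 1 + b \<in> Q" using lo[of "e / k" b] b e k by (simp add: algebra_simps)
      then have "t * ((e / k) *\<^sub>R 1 + b) + (e / k) *\<^sub>R (k *\<^sub>R 1 + - t) \<in> Q"
        using k e D(1) by (intro D(2)[OF D(3)[OF t] proper_module_scaleR[OF Q]]) auto
      then show ?thesis using k by (simp add: algebra_simps)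
    qed
    show ?thesis using *[of a] *[of "- a"] a minus by (intro eqI) (auto simp: algebra_simps)
  qed
  have ker: "cut Q (a * b) = 0" if "cut Q b = 0" for a b
  proof -
    obtain k where k: "0 < k" "k *\<^sub>R 1 + a \<in> M" by (rule archimedean_nonneg)
    have "a * b = (k *\<^sub>R 1 + a) * b - (k *\<^sub>R 1) * b" by (simp add: algebra_simps)
    then show ?thesis
      using kerM[OF k(2) that] kerM[OF scalar that, of k] k(1) diff by simp
  qed
  \<comment> \<open>Real homogeneity is read off the ideal property too, by multiplying an element
    of the kernel by \<open>r *\<^sub>R 1\<close>.\<close>
  have scale: "cut Q (r *\<^sub>R a) = r * cut Q a" for r a
  proof -
    have "cut Q ((r *\<^sub>R 1) * (a - cut Q a *\<^sub>R 1)) = 0"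
      by (rule ker) (simp add: diff scalar_cut)
    moreover have "(r *\<^sub>R 1) * (a - cut Q a *\<^sub>R 1) = r *\<^sub>R a - (r * cut Q a) *\<^sub>R 1"
      by (simp add: algebra_simps)
    ultimately show ?thesis by (simp add: diff scalar_cut)
  qed
  have "cut Q (a * b) = cut Q a * cut Q b" for a b
  proof -
    have "cut Q (a * (b - cut Q b *\<^sub>R 1)) = 0"
      by (rule ker) (simp add: diff scalar_cut)
    then show ?thesis by (simp add: algebra_simps diff scale)
  qed
  moreover have "linear (cut Q)" using add scale by (intro linearI) auto
  ultimately show "cut Q \<in> real_characters"
    using scalar_cut[of 1] by (auto simp: real_characters_def)
qed

text \<open>If \<open>- 1\<close> were in \<open>adjoin M (- b)\<close>, some \<open>t * b\<close>
  would equal \<open>1 + s\<close> with \<open>s\<close>, \<open>t\<close> in \<open>M\<close>, and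
  a descent would force \<open>b\<close> into \<open>M\<close>. So a maximal proper module contains
  \<open>- b\<close>, and its cut is the character sought.\<close>

lemma representation:
  assumes b: "b \<notin> M"
  obtains \<alpha> where "\<alpha> \<in> real_characters" "\<forall>a\<in>M. 0 \<le> \<alpha> a" "\<alpha> b \<le> 0"
proof -
  have "- 1 \<notin> adjoin M (- b)"
  proof
    assume "- 1 \<in> adjoin M (- b)"
    then obtain s t where st: "- 1 = s + t * - b" "s \<in> M" "t \<in> M" unfolding adjoin_def by blast
    then have tb: "t * b = 1 + s" by (simp add: algebra_simps)
    obtain k where k: "0 < k" "k *\<^sub>R 1 + - t \<in> M" by (rule archimedean_nonneg)
    \<comment> \<open>Expanding the product and using \<open>t * b = 1 + s\<close> leaves
      \<open>k\<close> times the target; \<open>0 \<le> r\<close> keeps \<open>r *\<^sub>R t\<close>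
      in \<open>M\<close>.\<close>
    have step: "b + (r - 1 / k) *\<^sub>R 1 \<in> M" if "0 \<le> r" "b + r *\<^sub>R 1 \<in> M" for r
    proof -
      have "(1 / k) *\<^sub>R ((k *\<^sub>R 1 + - t) * (b + r *\<^sub>R 1) + s + r *\<^sub>R t) \<in> M"
        using k(1) that(1)
        by (intro scaleR_mem add mult k(2) st(2,3) that(2)) auto
      also have "(k *\<^sub>R 1 + - t) * (b + r *\<^sub>R 1) + s + r *\<^sub>R t
          = k *\<^sub>R (b + (r - 1 / k) *\<^sub>R 1)"
        using tb k(1) by (simp add: algebra_simps)
      finally show ?thesis using k(1) by simp
    qed
    have desc: "b \<in> M" if "b + (real n / k) *\<^sub>R 1 \<in> M" for n
      using that
    proof (induction n)
      case (Suc n)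
      have "b + (real (Suc n) / k - 1 / k) *\<^sub>R 1 \<in> M" using Suc.prems k(1) by (intro step) auto
      then show ?case using Suc.IH by (simp add: diff_divide_distrib[symmetric])
    qed simp
    obtain c where c: "c *\<^sub>R 1 + b \<in> M" using archimedean by blast
    \<comment> \<open>Rounding \<open>c\<close> up to a multiple of \<open>1 / k\<close> lets the
      descent end exactly at \<open>b\<close>.\<close>
    obtain n :: nat where "c * k \<le> real n" using real_arch_simple by blast
    then have "0 \<le> real n / k - c" using k(1) by (simp add: field_simps)
    then have "(c *\<^sub>R 1 + b) + (real n / k - c) *\<^sub>R 1 \<in> M" by (intro add c scalar)
    then have "b + (real n / k) *\<^sub>R 1 \<in> M" by (simp add: algebra_simps)
    then show False using desc b by blast
  qed
  then have "proper_module (adjoin M (- b))"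
    by (intro proper_module_adjoin add mult) auto
  then obtain Q where Q: "proper_module Q" "adjoin M (- b) \<subseteq> Q"
    and max: "\<forall>Q'. proper_module Q' \<longrightarrow> Q \<subseteq> Q' \<longrightarrow> Q' = Q"
    by (rule ex_maximal_proper_module)
  note total = maximal_proper_module_total[OF Q(1) max]
  have "- b \<in> Q" using Q(2) mem_adjoin[of M "- b"] by blast
  then have "cut Q b \<le> 0" using cut_bounds(4)[OF Q(1) total, of 0 b] by simp
  moreover have "0 \<le> cut Q a" if "a \<in> M" for a
    using cut_character(2)[OF Q(1) total] proper_moduleD(1)[OF Q(1)] that by blast
  ultimately show thesis using cut_character(1)[OF Q(1) total] that by blast
qed

end

section \<open>Approximate roots near the unit\<close>

text \<open>
  Without completeness an \<open>m\<close>-th root of \<open>1 + a\<close> need not exist, but the Picard iteration for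
  \<open>z \<mapsto> z + (1 + a - (1 + z)\<^sup>m) / m\<close> still has steps tending to zero, and the step at \<open>z\<close> is
  \<open>1/m\<close> times the residual of \<open>(1 + z)\<^sup>m\<close>.
\<close>

lemma near_one_in_closure_powers:
  assumes m: "0 < m"
  obtains \<delta> where "0 < \<delta>"
    "\<And>a::'a::{real_normed_algebra, comm_ring_1}. norm a \<le> \<delta> \<Longrightarrow> 1 + a \<in> closure (range (\<lambda>x. x ^ m))"
proof -
  \<comment> \<open>The cofactor of \<open>z - w\<close> in
    \<open>(1 + z) ^ m - (1 + w) ^ m\<close>, less its value at the origin. Its smallness near the
    origin makes the Picard map a contraction.\<close>
  define \<Phi> :: "'a \<times> 'a \<Rightarrow> 'a" where
    "\<Phi> p = (\<Sum>i<m. (1 + snd p) ^ (m - Suc i) * (1 + fst p) ^ i) - real m *\<^sub>R 1" for p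
  have pow: "((\<lambda>p. f p ^ n) \<longlongrightarrow> l ^ n) F" if "(f \<longlongrightarrow> l) F" for f :: "'a \<times> 'a \<Rightarrow> 'a" and l n F
    by (induction n) (auto intro: tendsto_mult that)
  have "(\<Phi> \<longlongrightarrow> \<Phi> (0, 0)) (nhds (0, 0))"
    unfolding \<Phi>_def
    by (intro tendsto_intros pow tendsto_fst tendsto_snd filterlim_ident)
  moreover have "\<Phi> (0, 0) = 0" by (simp add: \<Phi>_def sum_constant_scaleR del: sum_constant)
  ultimately have "\<forall>\<^sub>F p in nhds (0, 0). norm (\<Phi> p) < 1/2"
    by (auto simp: tendsto_iff dist_norm dest: spec[of _ "1/2 :: real"])
  then obtain e where e: "0 < e" "\<And>p. dist p (0, 0) < e \<Longrightarrow> norm (\<Phi> p) < 1/2"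
    by (auto simp: eventually_nhds_metric)
  have \<Phi>: "norm (\<Phi> (z, w)) \<le> 1/2" if "norm z \<le> e/4" "norm w \<le> e/4" for z w
  proof -
    have "dist (z, w) (0, 0) < e" using norm_Pair_le[of z w] that e(1) by (simp add: dist_norm)
    then show ?thesis using e(2) by fastforce
  qed
  show thesis
  \<comment> \<open>The first iterate then has norm at most \<open>e/8\<close>, and contraction by
    \<open>1/2\<close> keeps all iterates within \<open>e/8 + e/8 = e/4\<close>, where the bound on
    \<Phi> holds.\<close>
  proof (rule that[of "e/8"])
    show "0 < e/8" using e(1) by simp
  next
    fix a :: 'a assume a: "norm a \<le> e/8"
    define g where "g z = z + (1 / real m) *\<^sub>R (1 + a - (1 + z) ^ m)" for z
    have m1: "1 \<le> real m" using m by simp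
    have lip: "norm (g z - g w) \<le> norm (z - w) / 2" if zw: "norm z \<le> e/4" "norm w \<le> e/4" for z w
    proof -
      have "(1 + z) ^ m - (1 + w) ^ m = (z - w) * (\<Phi> (z, w) + real m *\<^sub>R 1)"
        by (subst power_diff_sumr2) (simp add: \<Phi>_def)
      moreover have "g z - g w = (z - w) - (1 / real m) *\<^sub>R ((1 + z) ^ m - (1 + w) ^ m)"
        unfolding g_def by (simp add: scaleR_diff_right)
      ultimately have "g z - g w =
          (z - w) - (1 / real m) *\<^sub>R ((z - w) * (\<Phi> (z, w) + real m *\<^sub>R 1))"
        by (simp only:)
      \<comment> \<open>The unit term cancels before norms are taken, so the value of
        \<open>norm 1\<close> does not enter.\<close>
      also have "\<dots> = - ((1 / real m) *\<^sub>R ((z - w) * \<Phi> (z, w)))"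
        using m by (simp add: algebra_simps)
      finally have "norm (g z - g w) = norm ((z - w) * \<Phi> (z, w)) / real m" by simp
      also have "\<dots> \<le> norm ((z - w) * \<Phi> (z, w))"
        using m1 by (simp add: divide_le_eq mult_le_cancel_left1)
      also have "\<dots> \<le> norm (z - w) * norm (\<Phi> (z, w))" by (rule norm_mult_ineq)
      also have "\<dots> \<le> norm (z - w) * (1/2)" using \<Phi>[OF zw] by (rule mult_left_mono) simp
      finally show ?thesis by simp
    qed
    have g0: "norm (g 0) \<le> e/8"
    proof -
      have "norm (g 0) = norm a / real m" by (simp add: g_def)
      also have "\<dots> \<le> norm a" using m1 by (simp add: divide_le_eq mult_le_cancel_left1)
      finally show ?thesis using a by simp
    qed
    define z where "z n = (g ^^ n) 0" for n
    have z_Suc: "z (Suc n) = g (z n)" and z_0: "z 0 = 0" for n by (simp_all add: z_def)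
    have z_bound: "norm (z n) \<le> e/4" for n
    proof (induction n)
      case (Suc n)
      have "norm (g (z n)) \<le> norm (g (z n) - g 0) + norm (g 0)"
        using norm_triangle_ineq[of "g (z n) - g 0" "g 0"] by simp
      then show ?case using lip[of "z n" 0] Suc e(1) g0 by (simp add: z_Suc)
    qed (use e(1) in \<open>simp add: z_0\<close>)
    have steps: "norm (z (Suc n) - z n) \<le> e/8 * (1/2) ^ n" for n
    proof (induction n)
      case (Suc n)
      then show ?case using lip[OF z_bound z_bound, of "Suc n" n] by (simp add: z_Suc)
    qed (use g0 in \<open>simp add: z_Suc z_0\<close>)
    have "(\<lambda>n. e/8 * (1/2) ^ n) \<longlonglongrightarrow> e/8 * 0"
      by (intro tendsto_mult tendsto_const LIMSEQ_power_zero) simp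
    then have "(\<lambda>n. e/8 * (1/2) ^ n) \<longlonglongrightarrow> 0" by simp
    then have "(\<lambda>n. z (Suc n) - z n) \<longlonglongrightarrow> 0"
      by (rule Lim_null_comparison[OF always_eventually[OF allI[OF steps]]])
    then have "(\<lambda>n. (1 + a) - real m *\<^sub>R (z (Suc n) - z n)) \<longlonglongrightarrow> (1 + a) - real m *\<^sub>R 0"
      by (intro tendsto_intros)
    moreover have "(1 + a) - real m *\<^sub>R (z (Suc n) - z n) = (1 + z n) ^ m" for n
      using m by (simp add: z_Suc g_def)
    ultimately show "1 + a \<in> closure (range (\<lambda>x. x ^ m))"
      unfolding closure_sequential by (intro exI[of _ "\<lambda>n. (1 + z n) ^ m"]) simp
  qed
qed

section \<open>Sums of powers and their closure as a preprime\<close>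

lemma sums_of_powers_zero: "0 \<in> sums_of_powers m"
  unfolding sums_of_powers_def by (auto intro: exI[of _ "[]"])

lemma power_mem_sums_of_powers: "x ^ m \<in> sums_of_powers m"
  unfolding sums_of_powers_def by (auto intro: exI[of _ "[x]"])

lemma sums_of_powers_add:
  assumes "a \<in> sums_of_powers m" "b \<in> sums_of_powers m"
  shows "a + b \<in> sums_of_powers m"
proof -
  obtain xs ys where "a = (\<Sum>x\<leftarrow>xs. x ^ m)" "b = (\<Sum>x\<leftarrow>ys. x ^ m)"
    using assms unfolding sums_of_powers_def by blast
  then have "a + b = (\<Sum>x\<leftarrow>xs @ ys. x ^ m)" by simp
  then show ?thesis unfolding sums_of_powers_def by blast
qed

lemma sums_of_powers_mult:
  assumes "a \<in> sums_of_powers m" "b \<in> sums_of_powers m"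
  shows "a * b \<in> sums_of_powers m"
proof -
  have pow: "x ^ m * (\<Sum>y\<leftarrow>ys. y ^ m) \<in> sums_of_powers m" for x :: 'a and ys
    by (induction ys)
      (auto simp: distrib_left simp flip: power_mult_distrib
        intro!: sums_of_powers_zero sums_of_powers_add power_mem_sums_of_powers)
  obtain xs ys where a: "a = (\<Sum>x\<leftarrow>xs. x ^ m)" and b: "b = (\<Sum>x\<leftarrow>ys. x ^ m)"
    using assms unfolding sums_of_powers_def by blast
  show ?thesis unfolding a b
    by (induction xs)
      (auto simp: distrib_right intro: sums_of_powers_zero sums_of_powers_add pow)
qed

lemma sums_of_powers_scalar:
  assumes "0 < m" "0 \<le> r"
  shows "r *\<^sub>R 1 \<in> (sums_of_powers m :: 'a::{real_algebra, comm_ring_1} set)"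
proof -
  have "(s *\<^sub>R (1::'a)) ^ n = s ^ n *\<^sub>R 1" for s n by (induction n) auto
  then have "(root m r *\<^sub>R (1::'a)) ^ m = r *\<^sub>R 1" using assms by simp
  then show ?thesis by (metis power_mem_sums_of_powers)
qed

lemma closure_closed_under:
  fixes f :: "'a::real_normed_vector \<Rightarrow> 'a \<Rightarrow> 'a"
  assumes "\<And>x y. x \<in> S \<Longrightarrow> y \<in> S \<Longrightarrow> f x y \<in> S"
    and "\<And>X Y x y. X \<longlonglongrightarrow> x \<Longrightarrow> Y \<longlonglongrightarrow> y \<Longrightarrow> (\<lambda>n. f (X n) (Y n)) \<longlonglongrightarrow> f x y"
    and "a \<in> closure S" "b \<in> closure S"
  shows "f a b \<in> closure S"
proof -
  obtain X Y where "\<And>n. X n \<in> S" "X \<longlonglongrightarrow> a" "\<And>n. Y n \<in> S" "Y \<longlonglongrightarrow> b"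
    using assms(3,4) unfolding closure_sequential by blast
  then show ?thesis
    unfolding closure_sequential using assms(1,2)
    by (intro exI[of _ "\<lambda>n. f (X n) (Y n)"]) auto
qed

text \<open>Scale \<open>a\<close> into the ball where \<open>1 + a\<close> is a limit of powers,
  then scale back by \<open>norm a / \<delta>\<close>. A bound linear in the norm gives both the
  archimedean axiom and the continuity of positive characters.\<close>

lemma closure_sums_of_powers_shift:
  assumes m: "0 < m"
  obtains C where "\<And>a::'a::{real_normed_algebra, comm_ring_1}.
      (C * norm a) *\<^sub>R 1 + a \<in> closure (sums_of_powers m)"
proof -
  obtain \<delta> where \<delta>: "0 < \<delta>"
    "\<And>a::'a. norm a \<le> \<delta> \<Longrightarrow> 1 + a \<in> closure (range (\<lambda>x. x ^ m))"
    using near_one_in_closure_powers[OF m] by blast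
  have sub: "closure (range (\<lambda>x. x ^ m)) \<subseteq> closure (sums_of_powers m :: 'a set)"
    by (intro closure_mono) (auto intro: power_mem_sums_of_powers)
  show thesis
  proof (rule that[of "1 / \<delta>"])
    fix a :: 'a
    show "(1 / \<delta> * norm a) *\<^sub>R 1 + a \<in> closure (sums_of_powers m)"
    proof (cases "a = 0")
      case True
      then show ?thesis using closure_subset sums_of_powers_zero by fastforce
    next
      case False
      let ?c = "norm a / \<delta>"
      have c: "0 < ?c" using False \<delta>(1) by simp
      have "1 + (1 / ?c) *\<^sub>R a \<in> closure (sums_of_powers m)"
        using \<delta> False sub by (intro subsetD[OF sub] \<delta>(2)) auto
      moreover have "?c *\<^sub>R 1 \<in> closure (sums_of_powers m :: 'a set)"
        using sums_of_powers_scalar[OF m less_imp_le[OF c]] closure_subset by blast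
      ultimately have "(?c *\<^sub>R 1) * (1 + (1 / ?c) *\<^sub>R a) \<in> closure (sums_of_powers m)"
        by (intro closure_closed_under[where f = "(*)"] sums_of_powers_mult tendsto_mult)
      also have "(?c *\<^sub>R 1) * (1 + (1 / ?c) *\<^sub>R a) = (1 / \<delta> * norm a) *\<^sub>R 1 + a"
        using c False \<delta>(1) by (simp add: algebra_simps)
      finally show ?thesis .
    qed
  qed
qed

lemma archimedean_preprime_closure_sums_of_powers:
  assumes m: "0 < m"
  shows "archimedean_preprime
    (closure (sums_of_powers m) :: 'a::{real_normed_algebra, comm_ring_1} set)"
proof
  show "a + b \<in> closure (sums_of_powers m)"
    if "a \<in> closure (sums_of_powers m)" "b \<in> closure (sums_of_powers m)" for a b :: 'a
    using that by (intro closure_closed_under[where f = "(+)"] sums_of_powers_add tendsto_add)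
  show "a * b \<in> closure (sums_of_powers m)"
    if "a \<in> closure (sums_of_powers m)" "b \<in> closure (sums_of_powers m)" for a b :: 'a
    using that by (intro closure_closed_under[where f = "(*)"] sums_of_powers_mult tendsto_mult)
  show "r *\<^sub>R 1 \<in> closure (sums_of_powers m :: 'a set)" if "0 \<le> r" for r
    using sums_of_powers_scalar[OF m that] closure_subset by blast
  show "\<exists>k. k *\<^sub>R 1 + a \<in> closure (sums_of_powers m)" for a :: 'a
    using closure_sums_of_powers_shift[OF m] by blast
qed

section \<open>Characters\<close>

lemma real_characterD:
  assumes "\<alpha> \<in> real_characters"
  shows "linear \<alpha>" "\<alpha> (x * y) = \<alpha> x * \<alpha> y" "\<alpha> 1 = 1" "\<alpha> (x ^ n) = \<alpha> x ^ n"
proof -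
  show *: "linear \<alpha>" "\<alpha> (x * y) = \<alpha> x * \<alpha> y" "\<alpha> 1 = 1" for x y
    using assms by (auto simp: real_characters_def)
  show "\<alpha> (x ^ n) = \<alpha> x ^ n" by (induction n) (simp_all add: *)
qed

lemma real_character_sums_of_powers_nonneg:
  assumes "\<alpha> \<in> real_characters" "even m" "a \<in> sums_of_powers m"
  shows "0 \<le> \<alpha> a"
proof -
  note D = real_characterD[OF assms(1)]
  have "0 \<le> \<alpha> (\<Sum>x\<leftarrow>xs. x ^ m)" for xs
    using assms(2)
    by (induction xs) (auto simp: linear_0[OF D(1)] linear_add[OF D(1)] D(4) zero_le_even_power)
  then show ?thesis using assms(3) by (auto simp: sums_of_powers_def)
qed

text \<open>Even powers have nonnegative values, and continuity carries this to the closure.\<close>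

lemma gelfand_spectrum_nonneg:
  assumes \<alpha>: "\<alpha> \<in> gelfand_spectrum" and m: "even m" and a: "a \<in> closure (sums_of_powers m)"
  shows "0 \<le> \<alpha> a"
proof -
  have "\<alpha> ` closure (sums_of_powers m) \<subseteq> {0..}"
  proof (rule image_closure_subset)
    show "continuous_on (closure (sums_of_powers m)) \<alpha>"
      using \<alpha> continuous_on_subset by (auto simp: gelfand_spectrum_def)
    show "\<alpha> ` sums_of_powers m \<subseteq> {0..}"
      using \<alpha> m real_character_sums_of_powers_nonneg by (auto simp: gelfand_spectrum_def)
  qed simp
  then show ?thesis using a by auto
qed

text \<open>Positivity at the shifts of \<open>a\<close> and of \<open>- a\<close> bounds
  \<open>\<alpha> a\<close> from both sides.\<close>

lemma abs_le_if_nonneg_shift: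
  assumes \<alpha>: "\<alpha> \<in> real_characters"
    and nonneg: "\<And>a. 0 \<le> \<alpha> ((C * norm a) *\<^sub>R 1 + a)"
  shows "\<bar>\<alpha> a\<bar> \<le> C * norm (a::'a::{real_normed_algebra, comm_ring_1})"
proof -
  note D = real_characterD[OF \<alpha>]
  show ?thesis using nonneg[of a] nonneg[of "- a"]
    by (simp add: linear_add[OF D(1)] linear_diff[OF D(1)] linear_scale[OF D(1)] D(3))
qed

lemma gelfand_spectrumI:
  assumes \<alpha>: "\<alpha> \<in> real_characters" and bound: "\<And>a. \<bar>\<alpha> a\<bar> \<le> C * norm a"
  shows "\<alpha> \<in> gelfand_spectrum"
proof -
  have "bounded_linear \<alpha>"
    using real_characterD(1)[OF \<alpha>] bound
    by (intro bounded_linear.intro)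
      (auto simp: linear_conv_bounded_linear bounded_linear_axioms_def mult.commute)
  then show ?thesis using \<alpha> by (simp add: gelfand_spectrum_def linear_continuous_on)
qed

section \<open>Compactness in the topology of pointwise convergence\<close>

text \<open>Each defining equation involves finitely many evaluations, and these are
  continuous.\<close>

lemma closed_real_characters:
  "closed (real_characters :: ('a::{real_algebra, comm_ring_1} \<Rightarrow> real) set)"
proof -
  have "(real_characters :: ('a \<Rightarrow> real) set) =
    {\<alpha>. \<forall>x y. \<alpha> (x + y) = \<alpha> x + \<alpha> y} \<inter> {\<alpha>. \<forall>r x. \<alpha> (r *\<^sub>R x) = r * \<alpha> x} \<inter>
    {\<alpha>. \<forall>x y. \<alpha> (x * y) = \<alpha> x * \<alpha> y} \<inter> {\<alpha>. \<alpha> 1 = 1}"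
    by (auto simp: real_characters_def linear_iff)
  moreover have "closed \<dots>"
    by (intro closed_Int closed_Collect_all closed_Collect_eq continuous_intros
        continuous_on_product_coordinates)
  ultimately show ?thesis by simp
qed

text \<open>Tychonoff for a product of intervals whose lengths may vary with
  \<open>a\<close>.\<close>

lemma compact_bounded_functions: "compact {\<alpha> :: 'a \<Rightarrow> real. \<forall>a. \<bar>\<alpha> a\<bar> \<le> c a}"
proof -
  have "compactin (product_topology (\<lambda>_. euclidean) UNIV) (\<Pi>\<^sub>E a\<in>UNIV. {- c a..c a})"
    by (subst compactin_PiE) auto
  moreover have "(\<Pi>\<^sub>E a\<in>UNIV. {- c a..c a}) = {\<alpha>. \<forall>a. \<bar>\<alpha> a\<bar> \<le> c a}"
    by (auto simp: PiE_def Pi_def abs_le_iff minus_le_iff)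
  ultimately show ?thesis by (simp add: euclidean_product_topology)
qed

theorem theorem5p3:
  fixes d :: nat
  assumes "(real_characters :: ('a::{real_normed_algebra, comm_ring_1} \<Rightarrow> real) set) \<noteq> {}"
    and "d \<ge> 1"
  shows "compact (gelfand_spectrum :: ('a \<Rightarrow> real) set) \<and>
    closure (sums_of_powers (2 * d)) = Psd (gelfand_spectrum :: ('a \<Rightarrow> real) set)"
proof
  let ?M = "closure (sums_of_powers (2 * d)) :: 'a set"
  have d: "0 < 2 * d" using assms(2) by simp
  interpret archimedean_preprime ?M by (rule archimedean_preprime_closure_sums_of_powers[OF d])
  obtain C where C: "\<And>a::'a. (C * norm a) *\<^sub>R 1 + a \<in> ?M"
    using closure_sums_of_powers_shift[OF d] by blast
  have bound: "\<bar>\<alpha> a\<bar> \<le> C * norm a"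
    if "\<alpha> \<in> real_characters" "\<forall>a\<in>?M. 0 \<le> \<alpha> a" for \<alpha> a
    by (rule abs_le_if_nonneg_shift[OF that(1)]) (use that(2) C in blast)
  \<comment> \<open>One constant \<open>C\<close> serves all continuous characters, which exhibits
    the spectrum as a closed subset of a compact product.\<close>
  have spectrum_eq: "gelfand_spectrum = real_characters \<inter> {\<alpha> :: 'a \<Rightarrow> real. \<forall>a. \<bar>\<alpha> a\<bar> \<le> C * norm a}"
  proof (intro equalityI subsetI)
    fix \<alpha> :: "'a \<Rightarrow> real" assume \<alpha>: "\<alpha> \<in> gelfand_spectrum"
    then have "\<alpha> \<in> real_characters" by (simp add: gelfand_spectrum_def)
    then show "\<alpha> \<in> real_characters \<inter> {\<alpha>. \<forall>a. \<bar>\<alpha> a\<bar> \<le> C * norm a}"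
      using bound[of \<alpha>] gelfand_spectrum_nonneg[OF \<alpha>, of "2 * d"] by auto
  qed (auto intro: gelfand_spectrumI)
  show "compact (gelfand_spectrum :: ('a \<Rightarrow> real) set)"
    unfolding spectrum_eq
    by (rule closed_Int_compact[OF closed_real_characters compact_bounded_functions])
  show "?M = Psd gelfand_spectrum"
  proof (intro equalityI subsetI)
    fix a assume "a \<in> ?M"
    then show "a \<in> Psd gelfand_spectrum"
      using gelfand_spectrum_nonneg[of _ "2 * d"] by (auto simp: Psd_def)
  next
    fix a :: 'a assume a: "a \<in> Psd gelfand_spectrum"
    \<comment> \<open>The shift by \<open>e\<close> is needed because \<open>representation\<close>
      yields only \<open>\<le> 0\<close>: a character vanishing at \<open>a\<close> would give no
      contradiction.\<close>
    have pos: "a + e *\<^sub>R 1 \<in> ?M" if e: "0 < e" for e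
    proof (rule ccontr)
      assume "a + e *\<^sub>R 1 \<notin> ?M"
      then obtain \<alpha> where \<alpha>: "\<alpha> \<in> real_characters" "\<forall>a\<in>?M. 0 \<le> \<alpha> a" "\<alpha> (a + e *\<^sub>R 1) \<le> 0"
        by (rule representation)
      have "\<alpha> \<in> gelfand_spectrum" by (rule gelfand_spectrumI[OF \<alpha>(1) bound[OF \<alpha>(1,2)]])
      then have "0 \<le> \<alpha> a" using a by (simp add: Psd_def)
      moreover have "\<alpha> (a + e *\<^sub>R 1) = \<alpha> a + e"
        using real_characterD(1,3)[OF \<alpha>(1)] by (simp add: linear_add linear_scale)
      ultimately show False using \<alpha>(3) e by simp
    qed
    have "(\<lambda>n. a + (1 / real (Suc n)) *\<^sub>R 1) \<longlonglongrightarrow> a + 0 *\<^sub>R 1"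
      by (intro tendsto_intros LIMSEQ_Suc[OF lim_1_over_n])
    then have "(\<lambda>n. a + (1 / real (Suc n)) *\<^sub>R 1) \<longlonglongrightarrow> a" by simp
    then show "a \<in> ?M"
      by (rule closed_sequentially[OF closed_closure pos, rotated]) simp
  qed
qed

end
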